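(* Let $r=2^f$ with $f\geq 2$, and let $\mathcal{I}=(\rho_1,\ldots,\rho_r)$ where $\rho_1,\ldots,\rho_r:\mathrm{ASL}(2,r)\to S_{r^2}$ are the representations affording the $r$ pairwise inequivalent $2$-transitive actions of $\mathrm{ASL}(2,r)$ of degree $r^2$. Then for each $i=1,\ldots,r$ the code $C(\mathrm{ASL}(2,r),\mathcal{I})$ has the same inner distance distribution, and therefore also the same minimum distance, as $\mathrm{Rep}_r(C(\mathrm{ASL}(2,r),\rho_i))$.
   Context: $\mathrm{ASL}(2,r)=N\rtimes\mathrm{SL}(2,r)$ acts on the row vectors $V=\mathbb{F}_r^2$, where $N$ is the group of translations. It is known that there are exactly $r$ conjugacy classes of complements of $N$ in $\mathrm{ASL}(2,r)$; the $r$ inequivalent $2$-transitive actions of degree $r^2$ are the actions on the right cosets of representatives of these classes. Two actions of a group $G$ on $\Omega,\Omega'$ are equivalent if there is a bijection $\lambda:\Omega\to\Omega'$ with $\lambda(\omega^g)=\lambda(\omega)^g$ for all $\omega\in\Omega$, $g\in G$, and inequivalent otherwise. Actions on sets of size $q=r^2$ are regarded as homomorphisms to $S_q$ by labelling points with $Q=\{1,\ldots,q\}$. For a group $T$ and a homomorphism $\rho:T\to S_q$ put $\alpha(t,\rho)=(1^{t\rho},\ldots,q^{t\rho})\in Q^q$ and $C(T,\rho)=\{\alpha(t,\rho):t\in T\}$. For $\mathcal{I}=(\rho_1,\ldots,\rho_r)$ put $C(T,\mathcal{I})=\{(\alpha(t,\rho_1),\ldots,\alpha(t,\rho_r)):t\in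 T\}\subseteq Q^{rq}$, and $\mathrm{Rep}_r(C(T,\rho))=\{(\alpha,\ldots,\alpha)\ (r\text{ copies}):\alpha\in C(T,\rho)\}$. With $d$ the Hamming distance, the inner distance distribution of a code $C\subseteq Q^m$ is $(a_0,\ldots,a_m)$ with $a_i=|\{(\alpha,\beta)\in C^2:d(\alpha,\beta)=i\}|/|C|$, and the minimum distance is the smallest distance between distinct codewords. *)

theory Defs
  imports "HOL-Analysis.Analysis" "HOL-Algebra.Sym_Groups"
begin

text \<open>
  Permutations act on the right, so a product \<open>g h\<close> means: first \<open>g\<close>, then \<open>h\<close>.
  The library's \<open>sym_group\<close> multiplies by \<open>(\<circ>)\<close>, i.e. in the opposite order.
\<close>

definition right_sym_group :: "nat \<Rightarrow> (nat \<Rightarrow> nat) monoid" where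
  "right_sym_group q = (sym_group q)\<lparr>mult := (\<lambda>g h. h \<circ> g)\<rparr>"

text \<open>
  \<open>ASL(2,F)\<close> is the semidirect product of the translation group by \<open>SL(2,F)\<close>. The pair
  \<open>(A, v)\<close> stands for the affine map \<open>x \<mapsto> x A + v\<close> of row vectors; the translations are the
  pairs \<open>(mat 1, v)\<close>. The lemma \<open>affine_act_mult\<close> below says that the product is again
  "first the left factor, then the right factor". For finite \<open>F\<close> with \<open>r\<close> elements this is
  \<open>ASL(2,r)\<close>.
\<close>

definition ASL2 :: "(('a::field^2^2) \<times> ('a^2)) monoid" where
  "ASL2 = \<lparr>carrier = {(A, v). det A = 1},
           mult = (\<lambda>(A, v) (B, w). (A ** B, v v* B + w)),
           one = (mat 1, 0)\<rparr>"

definition affine_act :: "('a::field^2^2) \<times> ('a^2) \<Rightarrow> 'a^2 \<Rightarrow> 'a^2" where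
  "affine_act = (\<lambda>(A, v) x. x v* A + v)"

definition two_transitive :: "('g, 'b) monoid_scheme \<Rightarrow> 'c set \<Rightarrow> ('g \<Rightarrow> 'c \<Rightarrow> 'c) \<Rightarrow> bool" where
  "two_transitive G \<Omega> \<rho> \<longleftrightarrow>
     (\<forall>x\<in>\<Omega>. \<forall>y\<in>\<Omega>. \<forall>x'\<in>\<Omega>. \<forall>y'\<in>\<Omega>. x \<noteq> y \<longrightarrow> x' \<noteq> y' \<longrightarrow>
        (\<exists>g\<in>carrier G. \<rho> g x = x' \<and> \<rho> g y = y'))"

definition equivalent_actions ::
  "('g, 'b) monoid_scheme \<Rightarrow> 'c set \<Rightarrow> ('g \<Rightarrow> 'c \<Rightarrow> 'c) \<Rightarrow> 'd set \<Rightarrow> ('g \<Rightarrow> 'd \<Rightarrow> 'd) \<Rightarrow> bool" where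
  "equivalent_actions G \<Omega> \<rho> \<Omega>' \<rho>' \<longleftrightarrow>
     (\<exists>l. bij_betw l \<Omega> \<Omega>' \<and> (\<forall>\<omega>\<in>\<Omega>. \<forall>g\<in>carrier G. l (\<rho> g \<omega>) = \<rho>' g (l \<omega>)))"

text \<open>
  Words of length \<open>m\<close> over \<open>{1..q}\<close> are lists of length \<open>m\<close>; a word of length \<open>r * q\<close> given
  as an \<open>r\<close>-tuple of words of length \<open>q\<close> is the concatenation of these.
\<close>

definition perm_word :: "nat \<Rightarrow> 'g \<Rightarrow> ('g \<Rightarrow> nat \<Rightarrow> nat) \<Rightarrow> nat list" where
  "perm_word q t \<rho> = map (\<rho> t) [1..<Suc q]"

definition perm_code :: "('g, 'b) monoid_scheme \<Rightarrow> nat \<Rightarrow> ('g \<Rightarrow> nat \<Rightarrow> nat) \<Rightarrow> nat list set" where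
  "perm_code T q \<rho> = {perm_word q t \<rho> | t. t \<in> carrier T}"

definition perm_code_tuple ::
  "('g, 'b) monoid_scheme \<Rightarrow> nat \<Rightarrow> ('g \<Rightarrow> nat \<Rightarrow> nat) list \<Rightarrow> nat list set" where
  "perm_code_tuple T q \<I> = {concat (map (perm_word q t) \<I>) | t. t \<in> carrier T}"

definition Rep :: "nat \<Rightarrow> 'c list set \<Rightarrow> 'c list set" where
  "Rep r C = {concat (replicate r \<alpha>) | \<alpha>. \<alpha> \<in> C}"

definition hamming_dist :: "'c list \<Rightarrow> 'c list \<Rightarrow> nat" where
  "hamming_dist \<alpha> \<beta> = card {i. i < length \<alpha> \<and> \<alpha> ! i \<noteq> \<beta> ! i}"

text \<open>The list \<open>[a\<^sub>0, \<dots>, a\<^sub>m]\<close> for a code \<open>C\<close> of length \<open>m\<close>.\<close>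

definition inner_distance_distribution :: "nat \<Rightarrow> 'c list set \<Rightarrow> real list" where
  "inner_distance_distribution m C =
     map (\<lambda>i. real (card {(\<alpha>, \<beta>). \<alpha> \<in> C \<and> \<beta> \<in> C \<and> hamming_dist \<alpha> \<beta> = i}) / real (card C))
       [0..<Suc m]"

text \<open>Only meaningful for finite codes with at least two codewords.\<close>

definition minimum_distance :: "'c list set \<Rightarrow> nat" where
  "minimum_distance C = Min {hamming_dist \<alpha> \<beta> | \<alpha> \<beta>. \<alpha> \<in> C \<and> \<beta> \<in> C \<and> \<alpha> \<noteq> \<beta>}"

lemma affine_act_mult:
  "affine_act (g \<otimes>\<^bsub>ASL2\<^esub> h) x = affine_act h (affine_act g x)"
  by (cases g; cases h)
     (simp add: affine_act_def ASL2_def vector_matrix_mul_assoc vector_matrix_left_distrib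
        vector_matrix_mult_add_rdistrib add.assoc)

lemma affine_act_one: "affine_act \<one>\<^bsub>ASL2\<^esub> x = x"
  by (simp add: affine_act_def ASL2_def)

lemma affine_act_inj: "affine_act g = affine_act h \<Longrightarrow> g = h"
proof -
  assume eq: "affine_act g = affine_act h"
  obtain A v B w where gh: "g = (A, v)" "h = (B, w)" by (cases g; cases h) auto
  have "v = w" using fun_cong[OF eq, of 0] by (simp add: gh affine_act_def)
  then have "x v* A = x v* B" for x using fun_cong[OF eq, of x] by (simp add: gh affine_act_def)
  then have "transpose A = transpose B" by (simp add: matrix_eq)
  then show "g = h" using \<open>v = w\<close> gh by (metis transpose_transpose)
qed

lemma group_ASL2: "group (ASL2 :: (('a::field^2^2) \<times> ('a^2)) monoid)" (is "group ?G")
proof (rule groupI)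
  show "\<one>\<^bsub>?G\<^esub> \<in> carrier ?G" by (simp add: ASL2_def)
next
  fix g h :: "('a^2^2) \<times> ('a^2)" assume "g \<in> carrier ?G" "h \<in> carrier ?G"
  then show "g \<otimes>\<^bsub>?G\<^esub> h \<in> carrier ?G" by (auto simp: ASL2_def det_mul)
next
  fix g h k :: "('a^2^2) \<times> ('a^2)"
  show "g \<otimes>\<^bsub>?G\<^esub> h \<otimes>\<^bsub>?G\<^esub> k = g \<otimes>\<^bsub>?G\<^esub> (h \<otimes>\<^bsub>?G\<^esub> k)"
    by (rule affine_act_inj) (simp add: fun_eq_iff affine_act_mult)
next
  fix g :: "('a^2^2) \<times> ('a^2)"
  show "\<one>\<^bsub>?G\<^esub> \<otimes>\<^bsub>?G\<^esub> g = g"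
    by (rule affine_act_inj) (simp add: fun_eq_iff affine_act_mult affine_act_one)
next
  fix g :: "('a^2^2) \<times> ('a^2)" assume g: "g \<in> carrier ?G"
  obtain A v where Av: "g = (A, v)" by (cases g)
  with g have d: "det A = 1" by (simp add: ASL2_def)
  then have "invertible A" by (simp add: invertible_det_nz)
  then obtain B where B: "A ** B = mat 1" "B ** A = mat 1" by (auto simp: invertible_def)
  then have "det A * det B = 1" by (metis det_I det_mul)
  then have "(B, - (v v* B)) \<in> carrier ?G" using d by (simp add: ASL2_def)
  moreover have "(- (v v* B)) v* A = - v"
  proof -
    have "(- (v v* B)) v* A + (v v* B) v* A = 0"
      by (metis add.left_inverse vector_matrix_mult_0 vector_matrix_left_distrib)
    moreover have "(v v* B) v* A = v" by (simp add: vector_matrix_mul_assoc B)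
    ultimately show ?thesis by (simp add: eq_neg_iff_add_eq_0)
  qed
  then have "(B, - (v v* B)) \<otimes>\<^bsub>?G\<^esub> g = \<one>\<^bsub>?G\<^esub>" using B by (simp add: ASL2_def Av)
  ultimately show "\<exists>h\<in>carrier ?G. h \<otimes>\<^bsub>?G\<^esub> g = \<one>\<^bsub>?G\<^esub>" by blast
qed

lemma group_right_sym_group: "group (right_sym_group q)"
  by (rule groupI)
     (auto simp: right_sym_group_def sym_group_def o_assoc permutes_compose permutes_id
        permutes_inv_o intro: permutes_inv bexI[of _ "inv_into UNIV _"])

end

theory Submission
  imports Defs
begin

text \<open>
  All the actions have the same permutation character, so the two codes are isometric, word by word.
  By 2-transitivity the translation group acts regularly, as otherwise it acts trivially and
  \<open>SL(2,r)\<close> would be 2-transitive on more points than its order allows. The action thus becomes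
  \<open>w \<mapsto> w A + v + c(A)\<close> on vectors, for a 1-cocycle \<open>c\<close> of \<open>SL(2,r)\<close>. In characteristic 2, \<open>c\<close> is
  a coboundary on each cyclic subgroup: either \<open>A - 1\<close> is invertible, or \<open>A\<^sup>2 = 1\<close>, in which case
  \<open>c(A)\<close> lies in the kernel of \<open>A - 1\<close>, which coincides with its image when \<open>A \<noteq> 1\<close>. Hence every
  \<open>(A, v)\<close> has as many fixed points as in the natural affine action.
\<close>

subsection \<open>Codes parametrised by a group\<close>

lemma hamming_dist_eq_0_iff:
  assumes "length \<alpha> = length \<beta>"
  shows "hamming_dist \<alpha> \<beta> = 0 \<longleftrightarrow> \<alpha> = \<beta>"
  using assms by (auto simp: hamming_dist_def list_eq_iff_nth_eq)

lemma hamming_dist_append: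
  assumes "length \<alpha> = length \<beta>"
  shows "hamming_dist (\<alpha> @ \<gamma>) (\<beta> @ \<delta>) = hamming_dist \<alpha> \<beta> + hamming_dist \<gamma> \<delta>"
proof -
  let ?n = "length \<alpha>"
  let ?S = "{i. i < ?n \<and> \<alpha> ! i \<noteq> \<beta> ! i}" and ?T = "{i. i < length \<gamma> \<and> \<gamma> ! i \<noteq> \<delta> ! i}"
  have "{i. i < length (\<alpha> @ \<gamma>) \<and> (\<alpha> @ \<gamma>) ! i \<noteq> (\<beta> @ \<delta>) ! i} = ?S \<union> (+) ?n ` ?T" (is "?L = ?R")
  proof (intro equalityI subsetI)
    fix i assume "i \<in> ?L"
    then show "i \<in> ?R" using assms
      by (cases "i < ?n") (auto simp: nth_append intro!: image_eqI[of _ _ "i - ?n"])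
  qed (use assms in \<open>auto simp: nth_append\<close>)
  moreover have "card (?S \<union> (+) ?n ` ?T) = card ?S + card ((+) ?n ` ?T)"
    by (rule card_Un_disjoint) auto
  moreover have "card ((+) ?n ` ?T) = card ?T"
    by (rule card_image) simp
  ultimately show ?thesis by (simp add: hamming_dist_def)
qed

text \<open>Distances add over blocks. The hypothesis of one common block distance \<open>d\<close>
  fits the use made of it: the blocks will come from different actions that all give the same
  distance.\<close>

lemma hamming_dist_concat:
  assumes "\<And>x. x \<in> set xs \<Longrightarrow> length (g x) = length (h x)"
    and "\<And>x. x \<in> set xs \<Longrightarrow> hamming_dist (g x) (h x) = d"
  shows "hamming_dist (concat (map g xs)) (concat (map h xs)) = length xs * d"
  using assms
proof (induction xs)
  case Nil
  show ?case by (simp add: hamming_dist_def)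
next
  case (Cons x xs)
  then have "hamming_dist (concat (map g xs)) (concat (map h xs)) = length xs * d"
    "length (g x) = length (h x)" "hamming_dist (g x) (h x) = d" by auto
  then show ?case by (simp add: hamming_dist_append)
qed

lemma isometric_image:
  assumes inj: "inj_on k C"
    and dist: "\<And>\<alpha> \<beta>. \<alpha> \<in> C \<Longrightarrow> \<beta> \<in> C \<Longrightarrow> hamming_dist (k \<alpha>) (k \<beta>) = hamming_dist \<alpha> \<beta>"
  shows "inner_distance_distribution n (k ` C) = inner_distance_distribution n C"
    and "minimum_distance (k ` C) = minimum_distance C"
proof -
  have "card {(\<alpha>, \<beta>). \<alpha> \<in> k ` C \<and> \<beta> \<in> k ` C \<and> hamming_dist \<alpha> \<beta> = i}
      = card {(\<alpha>, \<beta>). \<alpha> \<in> C \<and> \<beta> \<in> C \<and> hamming_dist \<alpha> \<beta> = i}" (is "card ?V = card ?U") for i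
  proof -
    have "?V = map_prod k k ` ?U"
    proof (intro equalityI subsetI)
      fix z assume "z \<in> ?V"
      then obtain \<alpha> \<beta> where "z = map_prod k k (\<alpha>, \<beta>)" "\<alpha> \<in> C" "\<beta> \<in> C" "hamming_dist (k \<alpha>) (k \<beta>) = i"
        by auto
      then show "z \<in> map_prod k k ` ?U" using dist by (intro image_eqI) auto
    qed (use dist in auto)
    moreover have "inj_on (map_prod k k) ?U"
      by (rule inj_on_subset[OF map_prod_inj_on[OF inj inj]]) auto
    ultimately show ?thesis by (simp add: card_image)
  qed
  then show "inner_distance_distribution n (k ` C) = inner_distance_distribution n C"
    using inj by (simp add: inner_distance_distribution_def card_image)
  have "{hamming_dist \<alpha> \<beta> | \<alpha> \<beta>. \<alpha> \<in> k ` C \<and> \<beta> \<in> k ` C \<and> \<alpha> \<noteq> \<beta>}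
      = {hamming_dist (k \<alpha>) (k \<beta>) | \<alpha> \<beta>. \<alpha> \<in> C \<and> \<beta> \<in> C \<and> k \<alpha> \<noteq> k \<beta>}" by blast
  also have "\<dots> = {hamming_dist \<alpha> \<beta> | \<alpha> \<beta>. \<alpha> \<in> C \<and> \<beta> \<in> C \<and> \<alpha> \<noteq> \<beta>}"
    by (intro Collect_cong ex_cong1) (auto simp: dist inj_on_eq_iff[OF inj])
  finally show "minimum_distance (k ` C) = minimum_distance C"
    by (simp add: minimum_distance_def)
qed

text \<open>Neither \<open>u\<close> nor \<open>v\<close> need be injective, but words at distance 0
  coincide, so equal distances force both maps to have the same fibres. Hence
  \<open>v t \<mapsto> u t\<close> is a well-defined isometric bijection between the codes.\<close>

lemma isometric_codes:
  fixes u :: "'g \<Rightarrow> 'c list" and v :: "'g \<Rightarrow> 'd list"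
  assumes len: "\<And>t. t \<in> T \<Longrightarrow> length (u t) = m" "\<And>t. t \<in> T \<Longrightarrow> length (v t) = m"
    and dist: "\<And>s t. s \<in> T \<Longrightarrow> t \<in> T \<Longrightarrow> hamming_dist (u s) (u t) = hamming_dist (v s) (v t)"
  shows "inner_distance_distribution n (u ` T) = inner_distance_distribution n (v ` T)"
    and "minimum_distance (u ` T) = minimum_distance (v ` T)"
proof -
  have eq: "u s = u t \<longleftrightarrow> v s = v t" if "s \<in> T" "t \<in> T" for s t
    using hamming_dist_eq_0_iff[of "u s" "u t"] hamming_dist_eq_0_iff[of "v s" "v t"] len dist that
    by simp
  define k where "k = u \<circ> inv_into T v"
  have k: "k (v t) = u t" if t: "t \<in> T" for t
  proof -
    have "inv_into T v (v t) \<in> T" "v (inv_into T v (v t)) = v t"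
      using imageI[OF t, of v] by (rule inv_into_into, rule f_inv_into_f)
    then show ?thesis using eq t by (simp add: k_def)
  qed
  have "u ` T = k ` v ` T"
    unfolding image_image using k by (intro image_cong) auto
  moreover have "inj_on k (v ` T)"
    unfolding inj_on_def using k eq by auto
  moreover have "hamming_dist (k \<alpha>) (k \<beta>) = hamming_dist \<alpha> \<beta>" if "\<alpha> \<in> v ` T" "\<beta> \<in> v ` T" for \<alpha> \<beta>
    using that k dist by auto
  ultimately show "inner_distance_distribution n (u ` T) = inner_distance_distribution n (v ` T)"
    and "minimum_distance (u ` T) = minimum_distance (v ` T)"
    using isometric_image[of k "v ` T"] by auto
qed

lemma hamming_dist_perm_word:
  "hamming_dist (perm_word q s \<rho>) (perm_word q t \<rho>) = card {x \<in> {1..q}. \<rho> s x \<noteq> \<rho> t x}"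
proof -
  \<comment> \<open>Points are numbered from 1 and list positions from 0, so position
    \<open>i\<close> carries the image of \<open>Suc i\<close>.\<close>
  have "{x \<in> {1..q}. \<rho> s x \<noteq> \<rho> t x} = Suc ` {i. i < q \<and> \<rho> s (Suc i) \<noteq> \<rho> t (Suc i)}" (is "?L = ?R")
  proof (intro equalityI subsetI)
    fix x assume "x \<in> ?L"
    then show "x \<in> ?R" by (cases x) auto
  qed auto
  then have "card {x \<in> {1..q}. \<rho> s x \<noteq> \<rho> t x} = card {i. i < q \<and> \<rho> s (Suc i) \<noteq> \<rho> t (Suc i)}"
    by (simp add: card_image)
  then show ?thesis
    by (simp add: hamming_dist_def perm_word_def del: upt_Suc cong: conj_cong)
qed

subsection \<open>Matrices of size two in characteristic two\<close>

text \<open>The shift by 1 permutes the field, so summing \<open>x + 1\<close> and \<open>x\<close>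
  over it gives the same value; hence the order \<open>2 ^ f\<close> vanishes in the field, and so
  does 2.\<close>

lemma two_eq_0:
  assumes "CARD('a::{field,finite}) = 2 ^ f"
  shows "(2::'a) = 0"
proof -
  have "(\<Sum>x\<in>(UNIV::'a set). x + 1) = (\<Sum>x\<in>(UNIV::'a set). x)"
    by (rule sum.reindex_bij_witness[of _ "\<lambda>x. x - 1" "\<lambda>x. x + 1"]) auto
  then have "of_nat CARD('a) = (0::'a)"
    by (simp add: sum.distrib)
  then show ?thesis using assms by simp
qed

text \<open>Three entries determine the matrix: if \<open>A$1$1\<close> is nonzero, the determinant
  yields \<open>A$2$2\<close>; otherwise \<open>A$1$2\<close> is nonzero and yields
  \<open>A$2$1\<close>. The exact order is r^3 - r.\<close>

lemma card_SL2_le: "card {A :: 'a::{field,finite}^2^2. det A = 1} \<le> CARD('a) ^ 3"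
proof -
  let ?h = "\<lambda>A::'a^2^2. (A$1$1, A$1$2, if A$1$1 = 0 then A$2$2 else A$2$1)"
  have "inj_on ?h {A. det A = 1}"
  proof (rule inj_onI)
    fix A B :: "'a^2^2"
    assume AB: "A \<in> {A. det A = 1}" "B \<in> {A. det A = 1}" and h: "?h A = ?h B"
    then have d: "A$1$1 * A$2$2 - A$1$2 * A$2$1 = 1" "B$1$1 * B$2$2 - B$1$2 * B$2$1 = 1"
      by (simp_all add: det_2)
    have e: "A$1$1 = B$1$1" "A$1$2 = B$1$2" using h by auto
    have "A$2$1 = B$2$1 \<and> A$2$2 = B$2$2"
    proof (cases "A$1$1 = 0")
      case True
      then have "- (A$1$2 * A$2$1) = 1" "- (A$1$2 * B$2$1) = 1" using d e by simp_all
      then have "A$1$2 * A$2$1 = A$1$2 * B$2$1" "A$1$2 \<noteq> 0"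
        by (metis minus_minus, metis mult_zero_left neg_equal_0_iff_equal zero_neq_one)
      then show ?thesis using h True by auto
    next
      case False
      then have "A$2$1 = B$2$1" using h e by auto
      then have "A$1$1 * A$2$2 = A$1$1 * B$2$2" using d e by (simp add: algebra_simps)
      then show ?thesis using False \<open>A$2$1 = B$2$1\<close> by auto
    qed
    then show "A = B" using e by (simp add: vec_eq_iff forall_2)
  qed
  then have "card {A :: 'a^2^2. det A = 1} \<le> CARD('a \<times> 'a \<times> 'a)"
    by (rule card_inj_on_le) auto
  then show ?thesis by (simp add: card_cartesian_product power3_eq_cube)
qed

lemma row_vec_2:
  "(x :: 'a::comm_semiring_1^2) v* (A :: 'a^2^2)
    = vector [A$1$1 * x$1 + A$2$1 * x$2, A$1$2 * x$1 + A$2$2 * x$2]"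
  by (simp add: vec_eq_iff forall_2 vector_matrix_mult_def sum_2 mult.commute)

lemma one_cocycle_coboundary_at:
  fixes c :: "'a::field^2^2 \<Rightarrow> 'a^2"
  assumes two: "(2::'a) = 0"
    and cocycle: "\<And>A B. det A = 1 \<Longrightarrow> det B = 1 \<Longrightarrow> c (A ** B) = c A v* B + c B"
    and A: "det A = 1"
  shows "\<exists>u. u v* A + c A = u"
proof -
  have one: "c (mat 1) = 0"
    using cocycle[of "mat 1" "mat 1"] by simp
  have ch: "x + x = 0" "x + (x + y) = y" "x - y = x + y" for x y :: 'a
  proof -
    show 1: "x + x = 0" for x :: 'a using two by (metis mult_2 mult_zero_left)
    then show "x + (x + y) = y" by (simp flip: add.assoc)
    show "x - y = x + y" using 1[of y] by (metis add.right_neutral add_diff_cancel_right' add.assoc)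
  qed
  define p q s t where pqst: "p = A$1$1" "q = A$1$2" "s = A$2$1" "t = A$2$2"
  define x y where xy: "x = c A $ 1" "y = c A $ 2"
  have d: "p * t - q * s = 1" using A by (simp add: det_2 pqst)
  have solve: ?thesis if "p * a + s * b + x = a" "q * a + t * b + y = b" for a b
    by (rule exI[of _ "vector [a, b]"])
       (use that in \<open>simp add: row_vec_2 vec_eq_iff forall_2 pqst xy\<close>)
  show ?thesis
  \<comment> \<open>For determinant 1 in characteristic 2, det(A - 1) = 2 - (p + t) = p + t, so the
    split is on whether A - 1 is singular.\<close>
  proof (cases "p = t")
    case False
    \<comment> \<open>\<open>e\<close> is \<open>det (A - 1)\<close>, and \<open>(m, n)\<close> is \<open>c(A)\<close> times the adjugate of \<open>A - 1\<close>.\<close>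
    define e where "e = p + t"
    have e: "e \<noteq> 0" using False ch by (auto simp: e_def add_eq_0_iff)
    define m n where "m = x * (t + 1) + y * s" and "n = x * q + y * (p + 1)"
    \<comment> \<open>These identities hold in every commutative ring; the right-hand sides are
      arranged to vanish once \<open>d\<close> and \<open>two\<close> are substituted.\<close>
    have "p * m + s * n + e * x - m = x * (p * t - q * s - 1) + 2 * (x * (p + q * s) + y * (p * s))"
      "q * m + t * n + e * y - n = y * (p * t - q * s - 1) + 2 * (y * (t + q * s) + x * (q * t))"
      unfolding m_def n_def e_def by algebra+
    then have "p * m + s * n + e * x = m" "q * m + t * n + e * y = n"
      unfolding d two by simp_all
    then have "p * (m / e) + s * (n / e) + x = m / e" "q * (m / e) + t * (n / e) + y = n / e"
      using e by (simp_all add: field_simps)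
    then show ?thesis by (rule solve)
  next
    case True
    \<comment> \<open>With trace 0 and determinant 1, Cayley-Hamilton gives A^2 = 1; the cocycle
      rule then puts c(A) into the kernel of A - 1.\<close>
    have sq: "p * p + q * s = 1" using d ch(3) True by metis
    then have "A ** A = mat 1"
      using True ch
      by (simp add: vec_eq_iff forall_2 matrix_matrix_mult_def mat_def sum_2 mult.commute
          add.commute flip: pqst)
    then have "c A v* A + c A = 0" using cocycle[OF A A] by (simp add: one)
    then have k: "p * x + s * y + x = 0" "q * x + p * y + y = 0"
      by (simp_all add: row_vec_2 vec_eq_iff forall_2 pqst xy True[unfolded pqst])
    have "(p + 1) * (p + 1) = p * p + 1 + 2 * p" by algebra
    then have d': "(p + 1) * (p + 1) = q * s" using ch(2)[of "p * p" "q * s"] by (simp add: two sq)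
    \<comment> \<open>A - 1 has rows (p + 1, q) and (s, p + 1) and is singular by \<open>d'\<close>.
      If an off-diagonal entry is nonzero, its row spans the image and also the kernel, so c(A) is
      \<open>w\<close> times that row; \<open>w\<close> times the matching unit vector is then the
      solution.\<close>
    consider "q \<noteq> 0" | "s \<noteq> 0" | "q = 0" "s = 0" by blast
    then show ?thesis
    proof cases
      case 1
      have "q * x - (p + 1) * y = 0" unfolding ch(3) using k by (simp add: algebra_simps)
      then have "y = q * (y / q)" "x = (p + 1) * (y / q)" using 1 by (simp_all add: field_simps)
      moreover define w where "w = y / q"
      ultimately have "y = q * w" "x = (p + 1) * w" by simp_all
      then show ?thesis
        by (intro solve[of w 0]) (simp_all add: algebra_simps ch)
    next
      case 2
      have "s * y - (p + 1) * x = 0" unfolding ch(3) using k by (simp add: algebra_simps)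
      then have "x = s * (x / s)" "y = (p + 1) * (x / s)" using 2 by (simp_all add: field_simps)
      moreover define w where "w = x / s"
      ultimately have "x = s * w" "y = (p + 1) * w" by simp_all
      then show ?thesis
        using True by (intro solve[of 0 w]) (simp_all add: algebra_simps ch)
    next
      case 3
      then have "p + 1 = 0" using d' by simp
      then have "p = 1" using ch(3)[of p 1] by simp
      then have "A = mat 1"
        using 3 True by (simp add: vec_eq_iff forall_2 mat_def flip: pqst)
      then show ?thesis using one by simp
    qed
  qed
qed

subsection \<open>Two-transitive actions of degree \<open>r\<^sup>2\<close>\<close>

text \<open>Labelling points by translations turns \<open>\<rho> g\<close> into an affine map with
  the same linear part as \<open>g\<close>; moving the origin to a fixed point of the image of (A,
  0) then recovers \<open>affine_act g\<close>.\<close>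

lemma card_fixpoints_two_transitive:
  fixes \<rho> :: "('a::{field,finite}^2^2) \<times> ('a^2) \<Rightarrow> nat \<Rightarrow> nat"
  assumes two: "(2::'a) = 0" and q: "q = (CARD('a))\<^sup>2"
    and hom: "\<rho> \<in> hom ASL2 (right_sym_group q)"
    and tt: "two_transitive ASL2 {1..q} \<rho>"
    and g: "g \<in> carrier ASL2"
  shows "card {x \<in> {1..q}. \<rho> g x = x} = card {w. affine_act g w = w}"
proof -
  interpret G: group "ASL2 :: (('a^2^2) \<times> ('a^2)) monoid" by (rule group_ASL2)
  let ?G = "ASL2 :: (('a^2^2) \<times> ('a^2)) monoid"
  have mem: "(A, v) \<in> carrier ?G \<longleftrightarrow> det A = 1" for A v by (simp add: ASL2_def)
  have mult: "(A, v) \<otimes>\<^bsub>?G\<^esub> (B, w) = (A ** B, v v* B + w)" for A B v w by (simp add: ASL2_def)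
  have one: "\<one>\<^bsub>?G\<^esub> = (mat 1, 0)" by (simp add: ASL2_def)
  have perm: "\<rho> h permutes {1..q}" if "h \<in> carrier ?G" for h
    using hom that by (auto simp: hom_def right_sym_group_def sym_group_def)
  have comp: "\<rho> (h \<otimes>\<^bsub>?G\<^esub> k) x = \<rho> k (\<rho> h x)" if "h \<in> carrier ?G" "k \<in> carrier ?G" for h k x
    using hom that by (auto simp: hom_def right_sym_group_def sym_group_def)
  have unit: "\<rho> \<one>\<^bsub>?G\<^esub> x = x" for x
    using comp[of "\<one>\<^bsub>?G\<^esub>" "\<one>\<^bsub>?G\<^esub>" x] perm[of "\<one>\<^bsub>?G\<^esub>"]
    by (metis G.l_one G.one_closed permutes_inj injD)
  have trans2: "\<exists>h\<in>carrier ?G. \<rho> h x = x' \<and> \<rho> h y = y'"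
    if "x \<in> {1..q}" "y \<in> {1..q}" "x' \<in> {1..q}" "y' \<in> {1..q}" "x \<noteq> y" "x' \<noteq> y'" for x y x' y'
    using tt that unfolding two_transitive_def by blast
  have "card {0, 1::'a} \<le> CARD('a)" by (rule card_mono) auto
  then have r2: "CARD('a) \<ge> 2" by simp
  \<comment> \<open>If all translations acted trivially, the action would factor through SL(2,r).
    Reaching every ordered pair of distinct points from (1, 2) takes at least q(q - 1) = r^4 - r^2
    matrices, which exceeds r^3 for r at least 2.\<close>
  have "\<exists>v x. x \<in> {1..q} \<and> \<rho> (mat 1, v) x \<noteq> x"
  proof (rule ccontr)
    assume "\<nexists>v x. x \<in> {1..q} \<and> \<rho> (mat 1, v) x \<noteq> x"
    then have triv: "\<rho> (mat 1, v) x = x" if "x \<in> {1..q}" for v x using that by blast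
    have drop: "\<rho> (A, v) x = \<rho> (A, 0) x" if "det A = 1" "x \<in> {1..q}" for A v x
      using comp[of "(A, 0)" "(mat 1, v)" x] triv[of "\<rho> (A, 0) x" v] that perm[of "(A, 0)"]
      by (simp add: mem mult permutes_in_image del: One_nat_def atLeastAtMost_iff)
    have "2 * 2 \<le> q" unfolding q power2_eq_square using r2 by (rule mult_mono) (use r2 in auto)
    then have q12: "1 \<in> {1..q}" "2 \<in> {1..q}" by auto
    have "{1..q} \<times> {1..q} - (\<lambda>x. (x, x)) ` {1..q} \<subseteq> (\<lambda>A. (\<rho> (A, 0) 1, \<rho> (A, 0) 2)) ` {A. det A = 1}"
    proof
      fix z assume z: "z \<in> {1..q} \<times> {1..q} - (\<lambda>x. (x, x)) ` {1..q}"
      then obtain x y where xy: "z = (x, y)" "x \<in> {1..q}" "y \<in> {1..q}" "x \<noteq> y" by blast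
      have "(1::nat) \<noteq> 2" by simp
      then obtain h where h: "h \<in> carrier ?G" "\<rho> h 1 = x" "\<rho> h 2 = y"
        using trans2[OF q12 xy(2,3)] xy(4) by blast
      obtain A v where "h = (A, v)" by (cases h)
      with h have "det A = 1" "\<rho> (A, v) 1 = x" "\<rho> (A, v) 2 = y" by (simp_all add: mem)
      then show "z \<in> (\<lambda>A. (\<rho> (A, 0) 1, \<rho> (A, 0) 2)) ` {A. det A = 1}"
        using drop[OF _ q12(1), of A v] drop[OF _ q12(2), of A v] xy(1) by (intro image_eqI[of _ _ A]) simp_all
    qed
    then have "card ({1..q} \<times> {1..q} - (\<lambda>x. (x, x)) ` {1..q})
        \<le> card ((\<lambda>A::'a^2^2. (\<rho> (A, 0) 1, \<rho> (A, 0) 2)) ` {A. det A = 1})"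
      by (rule card_mono[rotated]) simp
    also have "\<dots> \<le> card {A :: 'a^2^2. det A = 1}" by (rule card_image_le) simp
    also have "\<dots> \<le> CARD('a) ^ 3" by (rule card_SL2_le)
    also have "card ({1..q} \<times> {1..q} - (\<lambda>x. (x, x)) ` {1..q}) = q * q - q"
      by (subst card_Diff_subset) (auto simp: card_image inj_on_def card_cartesian_product)
    finally have "q * q \<le> CARD('a) ^ 3 + q" by linarith
    moreover have "CARD('a) ^ 3 + q < q * q"
    proof -
      have "CARD('a) + 1 < CARD('a) * CARD('a)"
        using mult_le_mono1[OF r2, of "CARD('a)"] r2 by linarith
      then have "q * (CARD('a) + 1) < q * (CARD('a) * CARD('a))"
        by (rule mult_strict_left_mono) (simp add: q)
      then show ?thesis by (simp add: q power2_eq_square power3_eq_cube algebra_simps)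
    qed
    ultimately show False by simp
  qed
  then obtain v\<^sub>0 x\<^sub>0 where x0: "x\<^sub>0 \<in> {1..q}" "\<rho> (mat 1, v\<^sub>0) x\<^sub>0 \<noteq> x\<^sub>0" by blast
  \<comment> \<open>The orbit map of the translation group at a point that some translation
    moves.\<close>
  define \<tau> where "\<tau> = (\<lambda>v. \<rho> (mat 1, v) x\<^sub>0)"
  have "{1..q} \<subseteq> range \<tau>"
  proof
    fix z assume z: "z \<in> {1..q}"
    show "z \<in> range \<tau>"
    proof (cases "z = x\<^sub>0")
      case True
      then show ?thesis using unit[of x\<^sub>0] by (intro image_eqI[of _ _ 0]) (simp_all add: \<tau>_def one)
    next
      case False
      have "\<tau> v\<^sub>0 \<in> {1..q}" using perm[of "(mat 1, v\<^sub>0)"] x0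
        by (simp add: \<tau>_def mem permutes_in_image del: atLeastAtMost_iff)
      \<comment> \<open>The stabiliser of the base point is transitive on the other points.
        Conjugating the translation by \<open>v\<^sub>0\<close> with \<open>h\<close> gives a
        translation again, and it takes the base point to \<open>z\<close>.\<close>
      then obtain h where h: "h \<in> carrier ?G" "\<rho> h x\<^sub>0 = x\<^sub>0" "\<rho> h (\<tau> v\<^sub>0) = z"
        using trans2[of x\<^sub>0 "\<tau> v\<^sub>0" x\<^sub>0 z] x0 z False unfolding \<tau>_def by metis
      obtain A v where Av: "h = (A, v)" by (cases h)
      obtain B w where Bw: "inv\<^bsub>?G\<^esub> h = (B, w)" by (cases "inv\<^bsub>?G\<^esub> h")
      have i: "inv\<^bsub>?G\<^esub> h \<in> carrier ?G" "inv\<^bsub>?G\<^esub> h \<otimes>\<^bsub>?G\<^esub> h = \<one>\<^bsub>?G\<^esub>" using h by simp_all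
      then have "B ** A = mat 1" unfolding Bw unfolding Av by (simp add: mult one)
      then obtain u where u: "inv\<^bsub>?G\<^esub> h \<otimes>\<^bsub>?G\<^esub> (mat 1, v\<^sub>0) \<otimes>\<^bsub>?G\<^esub> h = (mat 1, u)"
        unfolding Bw unfolding Av by (simp add: mult)
      have "\<rho> (inv\<^bsub>?G\<^esub> h) x\<^sub>0 = x\<^sub>0"
        using comp[of h "inv\<^bsub>?G\<^esub> h" x\<^sub>0] h i unit by simp
      then have "\<tau> u = z"
        using h i by (simp add: \<tau>_def mem comp flip: u)
      then show ?thesis by blast
    qed
  qed
  moreover have "range \<tau> \<subseteq> {1..q}"
    using perm x0 by (auto simp: \<tau>_def mem permutes_in_image simp del: atLeastAtMost_iff)
  ultimately have ran: "range \<tau> = {1..q}" by blast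
  \<comment> \<open>There are as many vectors as points, so surjectivity forces injectivity.\<close>
  have inj: "inj \<tau>"
    by (rule eq_card_imp_inj_on) (simp_all add: ran q)
  \<comment> \<open>The vector label of the image of the base point under (A, 0), the base point
    itself having label 0.\<close>
  define c where "c = (\<lambda>A. inv_into UNIV \<tau> (\<rho> (A, 0) x\<^sub>0))"
  have c: "\<tau> (c A) = \<rho> (A, 0) x\<^sub>0" if "det A = 1" for A
    unfolding c_def
    by (rule f_inv_into_f) (use perm x0 that in \<open>simp add: ran mem permutes_in_image del: atLeastAtMost_iff\<close>)
  have act: "\<rho> (A, v) (\<tau> w) = \<tau> (w v* A + v + c A)" if A: "det A = 1" for A v w
  proof -
    have "\<rho> (A, v) (\<tau> w) = \<rho> ((mat 1, w) \<otimes>\<^bsub>?G\<^esub> (A, v)) x\<^sub>0"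
      using A by (simp add: comp mem \<tau>_def)
    \<comment> \<open>Moving the linear part to the front lets it act on the base point, where
      \<open>c\<close> describes its effect.\<close>
    also have "(mat 1, w) \<otimes>\<^bsub>?G\<^esub> (A, v) = (A, 0) \<otimes>\<^bsub>?G\<^esub> (mat 1, w v* A + v)"
      by (simp add: mult)
    also have "\<rho> \<dots> x\<^sub>0 = \<rho> (mat 1, w v* A + v) (\<tau> (c A))"
      using A by (simp add: comp mem c)
    also have "\<dots> = \<rho> ((mat 1, c A) \<otimes>\<^bsub>?G\<^esub> (mat 1, w v* A + v)) x\<^sub>0"
      by (simp add: comp mem \<tau>_def)
    finally show ?thesis by (simp add: mult \<tau>_def add_ac)
  qed
  have "c (A ** B) = c A v* B + c B" if "det A = 1" "det B = 1" for A B
  proof -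
    have "\<tau> (c (A ** B)) = \<rho> ((A, 0) \<otimes>\<^bsub>?G\<^esub> (B, 0)) x\<^sub>0"
      using that by (simp add: c mult det_mul)
    also have "\<dots> = \<tau> (c A v* B + c B)"
      using that by (simp add: comp mem act flip: c)
    finally show ?thesis using inj by (simp add: inj_eq)
  qed
  moreover obtain A v where Av: "g = (A, v)" "det A = 1" using g by (cases g) (auto simp: mem)
  \<comment> \<open>In vector labels \<open>u\<close> is fixed by (A, 0); taking it as the new
    origin cancels c(A).\<close>
  ultimately obtain u where u: "u v* A + c A = u"
    using one_cocycle_coboundary_at[OF two] by metis
  have "{x \<in> {1..q}. \<rho> g x = x} = \<tau> ` {w. w v* A + v + c A = w}"
    unfolding ran[symmetric] using act Av inj by (auto simp: inj_eq)
  then have "card {x \<in> {1..q}. \<rho> g x = x} = card {w. w v* A + v + c A = w}"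
    using inj by (simp add: card_image inj_on_subset)
  also have "{w. w v* A + v + c A = w} = (+) u ` {w. affine_act g w = w}"
  proof (intro equalityI subsetI)
    have shift: "(u + w) v* A + v + c A = u + affine_act g w" for w
      using u by (simp add: Av affine_act_def vector_matrix_left_distrib algebra_simps)
    fix w
    show "w \<in> (+) u ` {w. affine_act g w = w}" if "w \<in> {w. w v* A + v + c A = w}"
      using that shift[of "w - u"] by (auto intro!: image_eqI[of _ _ "w - u"] simp: algebra_simps)
    show "w \<in> {w. w v* A + v + c A = w}" if "w \<in> (+) u ` {w. affine_act g w = w}"
      using that shift by auto
  qed
  also have "card \<dots> = card {w. affine_act g w = w}" by (rule card_image) simp
  finally show ?thesis .
qed

text \<open>The images of \<open>s\<close> and \<open>t\<close> agree at a point exactly when that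
  of s t^-1 fixes it. The resulting value does not mention \<open>\<rho>\<close>, so it is shared by
  all the actions.\<close>

lemma hamming_dist_perm_word_two_transitive:
  fixes \<rho> :: "('a::{field,finite}^2^2) \<times> ('a^2) \<Rightarrow> nat \<Rightarrow> nat"
  assumes two: "(2::'a) = 0" and q: "q = (CARD('a))\<^sup>2"
    and hom: "\<rho> \<in> hom ASL2 (right_sym_group q)"
    and tt: "two_transitive ASL2 {1..q} \<rho>"
    and s: "s \<in> carrier ASL2" and t: "t \<in> carrier ASL2"
  shows "hamming_dist (perm_word q s \<rho>) (perm_word q t \<rho>)
    = q - card {w. affine_act (s \<otimes>\<^bsub>ASL2\<^esub> inv\<^bsub>ASL2\<^esub> t) w = w}"
proof -
  interpret G: group "ASL2 :: (('a^2^2) \<times> ('a^2)) monoid" by (rule group_ASL2)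
  let ?G = "ASL2 :: (('a^2^2) \<times> ('a^2)) monoid"
  define k where "k = s \<otimes>\<^bsub>?G\<^esub> inv\<^bsub>?G\<^esub> t"
  have k: "k \<in> carrier ?G" "k \<otimes>\<^bsub>?G\<^esub> t = s" using s t by (simp_all add: k_def G.m_assoc)
  have "\<rho> (h \<otimes>\<^bsub>?G\<^esub> h') x = \<rho> h' (\<rho> h x)" if "h \<in> carrier ?G" "h' \<in> carrier ?G" for h h' x
    using hom that by (auto simp: hom_def right_sym_group_def sym_group_def)
  from this[OF k(1) t] have "\<rho> s x = \<rho> t (\<rho> k x)" for x by (simp add: k)
  moreover have "inj (\<rho> t)"
    using hom t by (auto simp: hom_def right_sym_group_def sym_group_def intro: permutes_inj)
  ultimately have "\<rho> s x \<noteq> \<rho> t x \<longleftrightarrow> \<rho> k x \<noteq> x" for x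
    by (simp add: inj_eq)
  then have "{x \<in> {1..q}. \<rho> s x \<noteq> \<rho> t x} = {1..q} - {x \<in> {1..q}. \<rho> k x = x}"
    by blast
  then have "card {x \<in> {1..q}. \<rho> s x \<noteq> \<rho> t x} = card ({1..q} - {x \<in> {1..q}. \<rho> k x = x})"
    by (rule arg_cong)
  also have "\<dots> = q - card {x \<in> {1..q}. \<rho> k x = x}"
    by (subst card_Diff_subset) auto
  finally show ?thesis
    unfolding hamming_dist_perm_word card_fixpoints_two_transitive[OF two q hom tt k(1)] k_def[symmetric] .
qed

theorem theorem5p1:
  fixes f r :: nat
    and \<I> :: "(('a::{field,finite}^2^2) \<times> ('a^2) \<Rightarrow> nat \<Rightarrow> nat) list"
  assumes "f \<ge> 2" and "r = 2 ^ f" and "CARD('a) = r"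
    and "length \<I> = r"
    and "\<forall>i<r. \<I> ! i \<in> hom ASL2 (right_sym_group (r\<^sup>2))"
    and "\<forall>i<r. two_transitive ASL2 {1..r\<^sup>2} (\<I> ! i)"
    and "\<forall>i<r. \<forall>j<r. i \<noteq> j \<longrightarrow>
           \<not> equivalent_actions ASL2 {1..r\<^sup>2} (\<I> ! i) {1..r\<^sup>2} (\<I> ! j)"
  shows "\<forall>i<r.
      inner_distance_distribution (r * r\<^sup>2) (perm_code_tuple ASL2 (r\<^sup>2) \<I>)
        = inner_distance_distribution (r * r\<^sup>2) (Rep r (perm_code ASL2 (r\<^sup>2) (\<I> ! i))) \<and>
      minimum_distance (perm_code_tuple ASL2 (r\<^sup>2) \<I>)
        = minimum_distance (Rep r (perm_code ASL2 (r\<^sup>2) (\<I> ! i)))"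
proof (intro allI impI)
  fix i assume i: "i < r"
  let ?G = "ASL2 :: (('a^2^2) \<times> ('a^2)) monoid"
  let ?q = "r\<^sup>2"
  let ?u = "\<lambda>t. concat (map (perm_word ?q t) \<I>)"
  \<comment> \<open>The repeated word is written as a concatenation over a constant list of actions,
    so that both codes are parametrised by \<open>t\<close> in the same form.\<close>
  let ?v = "\<lambda>t. concat (map (perm_word ?q t) (replicate r (\<I> ! i)))"
  have two: "(2::'a) = 0" using assms(2,3) two_eq_0 by blast
  have codes: "perm_code_tuple ?G ?q \<I> = ?u ` carrier ?G"
    "Rep r (perm_code ?G ?q (\<I> ! i)) = ?v ` carrier ?G"
    by (auto simp: perm_code_tuple_def Rep_def perm_code_def)
  have word: "length (perm_word ?q t \<rho>) = ?q" for t and \<rho> :: "('a^2^2) \<times> ('a^2) \<Rightarrow> nat \<Rightarrow> nat"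
    by (simp add: perm_word_def del: upt_Suc)
  have len: "length (concat (map (perm_word ?q t) \<J>)) = length \<J> * ?q" for t
    and \<J> :: "(('a^2^2) \<times> ('a^2) \<Rightarrow> nat \<Rightarrow> nat) list"
    by (induction \<J>) (simp_all add: word)
  have dist: "hamming_dist (?u s) (?u t) = hamming_dist (?v s) (?v t)"
    if "s \<in> carrier ?G" "t \<in> carrier ?G" for s t
  proof -
    let ?d = "?q - card {w. affine_act (s \<otimes>\<^bsub>ASL2\<^esub> inv\<^bsub>ASL2\<^esub> t) w = w}"
    have d: "hamming_dist (perm_word ?q s \<rho>) (perm_word ?q t \<rho>) = ?d" if "\<rho> \<in> set \<I>" for \<rho>
    proof (rule hamming_dist_perm_word_two_transitive[OF two])
      show "\<rho> \<in> hom ASL2 (right_sym_group ?q)" "two_transitive ASL2 {1..?q} \<rho>"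
        using that assms(4-6) by (auto simp: in_set_conv_nth)
    qed (use assms(3) \<open>s \<in> carrier ?G\<close> \<open>t \<in> carrier ?G\<close> in auto)
    have "hamming_dist (?u s) (?u t) = length \<I> * ?d"
      by (rule hamming_dist_concat) (simp_all add: word d)
    moreover have "hamming_dist (?v s) (?v t) = length (replicate r (\<I> ! i)) * ?d"
      by (rule hamming_dist_concat) (use i assms(4) in \<open>auto simp: word d\<close>)
    ultimately show ?thesis using assms(4) by simp
  qed
  show "inner_distance_distribution (r * ?q) (perm_code_tuple ASL2 ?q \<I>)
        = inner_distance_distribution (r * ?q) (Rep r (perm_code ASL2 ?q (\<I> ! i))) \<and>
      minimum_distance (perm_code_tuple ASL2 ?q \<I>) = minimum_distance (Rep r (perm_code ASL2 ?q (\<I> ! i)))"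
    unfolding codes
    by (intro conjI isometric_codes[where m = "r * ?q"] dist) (simp_all only: len assms(4) length_replicate)
qed

end
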